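(* Let $n,k$ be integers with $k\ge2$ and $n\ge 2k$. For every real symmetric $n\times n$ matrix $A\in\Gamma_k$, $$L_k(A)^2\preceq\frac{n-k}{n}\,\operatorname{tr}\bigl(L_k(A)A\bigr)\,T_{k-1}(A).$$
   Context: For a real symmetric $n\times n$ matrix $A$, $\sigma_j(A)$ is the $j$-th elementary symmetric function of its eigenvalues ($\sigma_0=1$), and $\Gamma_k=\{A:\sigma_j(A)>0,\ 1\le j\le k\}$. For $0\le j\le n-1$ the $j$-th Newton tensor is $$T_j(A)=\frac{\partial\sigma_{j+1}(A)}{\partial A}=\sigma_j(A)\,\mathrm{Id}-\sigma_{j-1}(A)A+\cdots+(-1)^jA^j,$$ and $L_k(A)=\frac{n-k}{n}\sigma_k(A)\,\mathrm{Id}-T_k(A)$. $B\preceq C$ means that $C-B$ is positive semidefinite. *)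

theory Defs
  imports
    "Jordan_Normal_Form.Char_Poly"
    "HOL-Library.Multiset"
begin

text \<open>Elementary symmetric functions. The sum runs over sets of positions, so repeated
  entries of the list count separately; for \<open>j = 0\<close> the only term is the empty product.\<close>

definition elem_sym :: "nat \<Rightarrow> real list \<Rightarrow> real" where
  "elem_sym j xs = (\<Sum>I | I \<subseteq> {..<length xs} \<and> card I = j. \<Prod>i\<in>I. xs ! i)"

text \<open>The real eigenvalues in increasing order, repeated according to their multiplicity as
  roots of the characteristic polynomial. A real symmetric matrix has only real eigenvalues, so
  for such a matrix this is the complete list, of length \<open>dim_row A\<close>.\<close>

definition eigenvalue_list :: "real mat \<Rightarrow> real list" where
  "eigenvalue_list A = sorted_list_of_multiset (proots (char_poly A))"

definition sigma :: "nat \<Rightarrow> real mat \<Rightarrow> real" where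
  "sigma j A = elem_sym j (eigenvalue_list A)"

definition sym_mats :: "nat \<Rightarrow> real mat set" where
  "sym_mats n = {A \<in> carrier_mat n n. transpose_mat A = A}"

definition Gamma_cone :: "nat \<Rightarrow> nat \<Rightarrow> real mat set" where
  "Gamma_cone n k = {A \<in> sym_mats n. \<forall>j\<in>{1..k}. sigma j A > 0}"

text \<open>The Newton tensor
  \<open>\<sigma>\<^sub>j(A) Id - \<sigma>\<^bsub>j-1\<^esub>(A) A + \<dots> + (-1)\<^sup>j A\<^sup>j\<close>, with the sum of matrices
  written entrywise.\<close>

definition newton_tensor :: "nat \<Rightarrow> real mat \<Rightarrow> real mat" where
  "newton_tensor j A = mat (dim_row A) (dim_row A)
     (\<lambda>rc. \<Sum>i\<le>j. (- 1) ^ i * sigma (j - i) A * (A ^\<^sub>m i) $$ rc)"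

definition L_tensor :: "nat \<Rightarrow> real mat \<Rightarrow> real mat" where
  "L_tensor k A =
     ((real (dim_row A) - real k) / real (dim_row A) * sigma k A) \<cdot>\<^sub>m 1\<^sub>m (dim_row A)
       - newton_tensor k A"

definition mat_trace :: "real mat \<Rightarrow> real" where
  "mat_trace M = (\<Sum>i<dim_row M. M $$ (i, i))"

definition pos_semidef :: "nat \<Rightarrow> real mat \<Rightarrow> bool" where
  "pos_semidef n M \<longleftrightarrow> M \<in> sym_mats n \<and> (\<forall>v\<in>carrier_vec n. 0 \<le> v \<bullet> (M *\<^sub>v v))"

definition psd_le :: "nat \<Rightarrow> real mat \<Rightarrow> real mat \<Rightarrow> bool" where
  "psd_le n B C \<longleftrightarrow> B \<in> carrier_mat n n \<and> C \<in> carrier_mat n n \<and> pos_semidef n (C - B)"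

end

theory Submission
  imports Defs
begin

text \<open>
  Everything reduces to eigenvalues. By the spectral theorem write \<open>A = U diag(d) U\<^sup>T\<close> with \<open>U\<close>
  orthogonal. Any matrix polynomial in \<open>A\<close> is then \<open>U diag(f) U\<^sup>T\<close> for some \<open>f\<close>, and it is
  positive semidefinite as soon as all \<open>f\<^sub>r \<ge> 0\<close>. Fix an index \<open>r\<close>, put \<open>x = d\<^sub>r\<close> and let \<open>s\<^sub>j\<close> be
  the elementary symmetric functions of the other \<open>n - 1\<close> eigenvalues. The \<open>r\<close>-th eigenvalue of
  \<open>T\<^sub>j(A)\<close> is \<open>s\<^sub>j\<close>, since the alternating sum that defines \<open>T\<^sub>j\<close> undoes the recurrence
  \<open>\<sigma>\<^sub>j = s\<^sub>j + x s\<^bsub>j-1\<^esub>\<close>. The trace is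
  \<open>tr(L\<^sub>k(A) A) = a \<sigma>\<^sub>1 \<sigma>\<^sub>k - (k+1) \<sigma>\<^bsub>k+1\<^esub>\<close>, where \<open>a = (n-k)/n\<close>. What is left is an
  inequality between numbers:
  \<open>(a \<sigma>\<^sub>k - s\<^sub>k)\<^sup>2 \<le> a (a \<sigma>\<^sub>1 \<sigma>\<^sub>k - (k+1) \<sigma>\<^bsub>k+1\<^esub>) s\<^bsub>k-1\<^esub>\<close>.

  Once every \<open>\<sigma>\<^sub>j\<close> is expressed through \<open>x\<close> and the \<open>s\<^sub>j\<close>, the two terms in \<open>x\<^sup>2\<close> cancel. The
  difference of the two sides is affine in \<open>x\<close>, and expanding it around the zero of
  \<open>\<sigma>\<^sub>k = s\<^sub>k + x s\<^bsub>k-1\<^esub>\<close> gives, after multiplication by \<open>n\<^sup>2\<close>,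
  \<open>(n-k) \<sigma>\<^sub>k [(n-k) s\<^sub>1 s\<^bsub>k-1\<^esub> - k(n-1) s\<^sub>k] + n [k(n-k-1) s\<^sub>k\<^sup>2 - (k+1)(n-k) s\<^bsub>k-1\<^esub> s\<^bsub>k+1\<^esub>]\<close>.
  For the \<open>n - 1\<close> remaining eigenvalues the second bracket is nonnegative by Newton's inequality
  (\<open>newton_inequality\<close>) and the first one by the Maclaurin-type consequence of Newton's
  inequality (\<open>maclaurin_step\<close>). The latter requires \<open>s\<^sub>j > 0\<close> for \<open>j < k\<close>, which
  \<open>esym_remove_pos\<close> derives from \<open>A \<in> \<Gamma>\<^sub>k\<close>.

  Newton's inequality itself holds for arbitrary real numbers, of any sign. The derivatives of a
  polynomial with only real roots again have only real roots (\<open>real_rooted_pderiv\<close>), and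
  Laguerre's inequality for the derivative of order \<open>j - 1\<close> of \<open>\<Prod>\<^sub>i (1 + l\<^sub>i X)\<close>, evaluated at \<open>0\<close>, is
  Newton's inequality of index \<open>j\<close>.
\<close>

section \<open>Real polynomials with only real roots\<close>

text \<open>The degree is not fixed and \<open>0\<close> is included (\<open>c = 0\<close>), so that the class is closed under
  differentiation and contains \<open>[:1, x:]\<close> also for \<open>x = 0\<close>.\<close>

definition real_rooted :: "real poly \<Rightarrow> bool" where
  "real_rooted p \<longleftrightarrow> (\<exists>c as. p = Polynomial.smult c (\<Prod>a\<leftarrow>as. [:- a, 1:]))"

lemma real_rooted_mult:
  assumes "real_rooted p" "real_rooted q"
  shows "real_rooted (p * q)"
proof -
  from assms obtain c as d bs
    where "p = Polynomial.smult c (\<Prod>a\<leftarrow>as. [:- a, 1:])" "q = Polynomial.smult d (\<Prod>b\<leftarrow>bs. [:- b, 1:])"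
    unfolding real_rooted_def by blast
  then have "p * q = Polynomial.smult (c * d) (\<Prod>a\<leftarrow>as @ bs. [:- a, 1:])"
    by (simp add: mult.commute)
  then show ?thesis unfolding real_rooted_def by blast
qed

lemma real_rooted_one: "real_rooted 1"
  unfolding real_rooted_def by (rule exI[of _ 1], rule exI[of _ "[]"]) simp

lemma real_rooted_linear: "real_rooted [:1, x:]"
proof (cases "x = 0")
  case True
  then show ?thesis using real_rooted_one by (simp add: one_pCons)
next
  case False
  then have "[:1, x:] = Polynomial.smult x (\<Prod>a\<leftarrow>[- 1 / x]. [:- a, 1:])" by simp
  then show ?thesis unfolding real_rooted_def by blast
qed

lemma real_rooted_prod:
  assumes "\<And>i. i \<in> I \<Longrightarrow> real_rooted (f i)"
  shows "real_rooted (prod f I)"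
  using assms
  by (induction I rule: infinite_finite_induct) (auto intro: real_rooted_mult real_rooted_one)

lemma pderiv_linear_factor_mult:
  "pderiv ([:- a, 1:] * q) = q + [:- a, 1:] * pderiv q" for a :: "'a :: idom"
  by (subst pderiv_mult) (simp add: pderiv_pCons)

text \<open>The core of the Gauss-Lucas theorem: \<open>P'/P\<close> is the sum of the \<open>1/(z - a)\<close>, and for real \<open>a\<close>
  each summand has an imaginary part of sign opposite to that of \<open>z\<close>. Hence \<open>P'\<close> has no zero
  off the real axis.\<close>

lemma Im_log_deriv_real_roots:
  fixes as :: "real list" and z :: complex
  defines "P \<equiv> \<lambda>as::real list. \<Prod>a\<leftarrow>as. [:- of_real a, 1:]"
  assumes z: "Im z \<noteq> 0"
    and as: "as \<noteq> []"
  shows "Im z * Im (poly (pderiv (P as)) z / poly (P as) z) < 0"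
proof -
  have "poly (P as) z \<noteq> 0 \<and> Im z * Im (poly (pderiv (P as)) z / poly (P as) z) \<le> 0 \<and>
    (as \<noteq> [] \<longrightarrow> Im z * Im (poly (pderiv (P as)) z / poly (P as) z) < 0)"
  proof (induction as)
    case Nil
    show ?case by (simp add: P_def pderiv_1)
  next
    case (Cons a as)
    let ?R = "poly (P as) z" and ?R' = "poly (pderiv (P as)) z"
    have za: "z - of_real a \<noteq> 0" using z by (auto simp: complex_eq_iff)
    have R: "?R \<noteq> 0" using Cons by blast
    have val: "poly (P (a # as)) z = (z - of_real a) * ?R" by (simp add: P_def algebra_simps)
    have der: "poly (pderiv (P (a # as))) z = (z - of_real a) * ?R' + ?R"
      unfolding P_def list.map prod_list.Cons pderiv_linear_factor_mult poly_add poly_mult by simp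
    have quot: "poly (pderiv (P (a # as))) z / poly (P (a # as)) z
        = ?R' / ?R + 1 / (z - of_real a)"
      unfolding val der using za R by (simp add: field_simps)
    have "Im z * Im (1 / (z - of_real a)) = - ((Im z)\<^sup>2 / ((Re z - a)\<^sup>2 + (Im z)\<^sup>2))"
      by (simp add: Im_divide power2_eq_square)
    also have "\<dots> < 0"
      using z by (simp add: add_nonneg_pos)
    finally have lt: "Im z * Im (1 / (z - of_real a)) < 0" .
    have "Im z * Im (?R' / ?R) \<le> 0" using Cons by blast
    then have "Im z * Im (poly (pderiv (P (a # as))) z / poly (P (a # as)) z) < 0"
      unfolding quot using lt by (simp add: distrib_left)
    then show ?case using za R val by simp
  qed
  then show ?thesis using as by blast
qed

lemma map_poly_of_real_roots:
  "map_poly complex_of_real (Polynomial.smult c (\<Prod>a\<leftarrow>as. [:- a, 1:]))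
     = Polynomial.smult (of_real c) (\<Prod>a\<leftarrow>as. [:- of_real a, 1:])"
proof -
  interpret map_poly_inj_idom_hom complex_of_real ..
  have "map_poly complex_of_real (\<Prod>a\<leftarrow>as. [:- a, 1:]) = (\<Prod>a\<leftarrow>as. [:- of_real a, 1:])"
    by (induction as) (simp_all add: hom_distribs)
  then show ?thesis by (simp add: hom_distribs)
qed

text \<open>The derivative splits over the complex numbers, and all its roots are real by Gauss-Lucas.
  Unlike an argument through Rolle's theorem, this needs no bookkeeping of multiplicities.\<close>

lemma real_rooted_pderiv:
  assumes "real_rooted p"
  shows "real_rooted (pderiv p)"
proof (cases "pderiv p = 0")
  case True
  then have "pderiv p = Polynomial.smult 0 (\<Prod>a\<leftarrow>[]. [:- a, 1:])" by simp
  then show ?thesis unfolding real_rooted_def by blast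
next
  case False
  interpret h: map_poly_inj_idom_hom complex_of_real ..
  from assms obtain c as where p: "p = Polynomial.smult c (\<Prod>a\<leftarrow>as. [:- a, 1:])"
    unfolding real_rooted_def by blast
  let ?P = "\<Prod>a\<leftarrow>as. [:- of_real a, 1:] :: complex poly"
  let ?q = "map_poly complex_of_real (pderiv p)"
  have c: "c \<noteq> 0" and as: "as \<noteq> []"
    using False p by (auto simp: pderiv_1 pderiv_smult)
  have q: "?q = Polynomial.smult (of_real c) (pderiv ?P)"
  proof -
    have "?q = pderiv (map_poly complex_of_real p)" by (rule of_real_hom.map_poly_pderiv)
    then show ?thesis unfolding p map_poly_of_real_roots pderiv_smult .
  qed
  have real: "Im z = 0" if "poly ?q z = 0" for z
  proof (rule ccontr)
    assume "Im z \<noteq> 0"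
    from Im_log_deriv_real_roots[OF this as] that c show False by (simp add: q)
  qed
  obtain zs where zs: "Polynomial.smult (lead_coeff ?q) (\<Prod>a\<leftarrow>zs. [:- a, 1:]) = ?q"
    using fundamental_theorem_algebra_factorized[of ?q] by blast
  have lead: "lead_coeff ?q = of_real (lead_coeff (pderiv p))" by simp
  have "\<forall>z\<in>set zs. Im z = 0"
  proof
    fix z assume "z \<in> set zs"
    then have "poly (\<Prod>a\<leftarrow>zs. [:- a, 1:]) z = 0" by (auto simp: poly_prod_list prod_list_zero_iff)
    then have "poly ?q z = 0" by (subst zs[symmetric]) simp
    then show "Im z = 0" by (rule real)
  qed
  then have "zs = map of_real (map Re zs)"
    by (auto simp: complex_eq_iff intro!: nth_equalityI)
  then have "(\<Prod>a\<leftarrow>zs. [:- a, 1:]) = (\<Prod>a\<leftarrow>map of_real (map Re zs). [:- a, 1:])" by (rule arg_cong)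
  also have "\<dots> = (\<Prod>a\<leftarrow>map Re zs. [:- of_real a, 1:])" by (simp only: map_map o_def)
  finally have "?q = map_poly of_real
      (Polynomial.smult (lead_coeff (pderiv p)) (\<Prod>a\<leftarrow>map Re zs. [:- a, 1:]))"
    unfolding map_poly_of_real_roots using zs unfolding lead by (simp only:)
  then have "pderiv p = Polynomial.smult (lead_coeff (pderiv p)) (\<Prod>a\<leftarrow>map Re zs. [:- a, 1:])"
    by (simp only: h.eq_iff)
  then show ?thesis unfolding real_rooted_def by blast
qed

text \<open>Off the roots this is Cauchy-Schwarz for the numbers \<open>1/(x - a)\<close>, because
  \<open>(q'\<^sup>2 - q q'')/q\<^sup>2\<close> is the sum of their squares and \<open>q'/q\<close> is their sum. Adding one linear
  factor at a time avoids the division by \<open>q\<close>.\<close>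

lemma laguerre_roots:
  fixes as :: "real list"
  defines "q \<equiv> \<lambda>as::real list. \<Prod>a\<leftarrow>as. [:- a, 1:]"
  shows "(poly (pderiv (q as)) x)\<^sup>2
    \<le> length as * ((poly (pderiv (q as)) x)\<^sup>2 - poly (q as) x * poly (pderiv (pderiv (q as))) x)"
proof (induction as)
  case Nil
  show ?case by (simp add: q_def pderiv_1)
next
  case (Cons a as)
  let ?t = "x - a" and ?d = "real (length as)"
  let ?r = "poly (q as) x" and ?r1 = "poly (pderiv (q as)) x"
  let ?r2 = "poly (pderiv (pderiv (q as))) x"
  let ?W = "?r1\<^sup>2 - ?r * ?r2"
  have v0: "poly (q (a # as)) x = ?t * ?r" by (simp add: q_def algebra_simps)
  have v1: "poly (pderiv (q (a # as))) x = ?r + ?t * ?r1"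
    unfolding q_def list.map prod_list.Cons pderiv_linear_factor_mult poly_add poly_mult by simp
  have v2: "poly (pderiv (pderiv (q (a # as)))) x = 2 * ?r1 + ?t * ?r2"
    unfolding q_def list.map prod_list.Cons pderiv_linear_factor_mult poly_add poly_mult pderiv_add
    by simp
  have IH: "?r1\<^sup>2 \<le> ?d * ?W" using Cons .
  have W: "(?r + ?t * ?r1)\<^sup>2 - ?t * ?r * (2 * ?r1 + ?t * ?r2) = ?r\<^sup>2 + ?t\<^sup>2 * ?W"
    by (simp add: power2_eq_square algebra_simps)
  have "(?r + ?t * ?r1)\<^sup>2 \<le> (?d + 1) * (?r\<^sup>2 + ?t\<^sup>2 * ?W)"
  proof (cases "as = []")
    case True
    then show ?thesis by (simp add: q_def pderiv_1)
  next
    case False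
    then have d: "?d > 0" by simp
    \<comment> \<open>Cauchy-Schwarz for \<open>(\<surd>d r) / \<surd>d + t r'\<close>; the defect is a square.\<close>
    have "?d * (?r + ?t * ?r1)\<^sup>2 \<le> (?d + 1) * (?d * ?r\<^sup>2 + ?t\<^sup>2 * ?r1\<^sup>2)"
    proof -
      have "(?d + 1) * (?d * ?r\<^sup>2 + ?t\<^sup>2 * ?r1\<^sup>2) - ?d * (?r + ?t * ?r1)\<^sup>2 = (?d * ?r - ?t * ?r1)\<^sup>2"
        by (simp add: power2_eq_square algebra_simps)
      then show ?thesis by (smt (verit) zero_le_power2)
    qed
    also have "\<dots> \<le> (?d + 1) * (?d * ?r\<^sup>2 + ?t\<^sup>2 * (?d * ?W))"
      using IH by (intro mult_left_mono add_left_mono) auto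
    also have "\<dots> = ?d * ((?d + 1) * (?r\<^sup>2 + ?t\<^sup>2 * ?W))" by (simp add: algebra_simps)
    finally show ?thesis using d by simp
  qed
  then show ?case unfolding v0 v1 v2 W by (simp add: add.commute)
qed

text \<open>Laguerre's inequality in terms of a degree bound only. The weaker bound is what makes
  Newton's inequality below independent of how many of the numbers vanish.\<close>

lemma laguerre_real_rooted:
  fixes d :: nat
  assumes "real_rooted p" and d: "degree p \<le> d"
  shows "(poly (pderiv p) x)\<^sup>2
    \<le> d * ((poly (pderiv p) x)\<^sup>2 - poly p x * poly (pderiv (pderiv p)) x)"
proof -
  from assms obtain c as where p: "p = Polynomial.smult c (\<Prod>a\<leftarrow>as. [:- a, 1:])"
    unfolding real_rooted_def by blast
  let ?q = "\<Prod>a\<leftarrow>as. [:- a, 1:]"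
  let ?W = "(poly (pderiv ?q) x)\<^sup>2 - poly ?q x * poly (pderiv (pderiv ?q)) x"
  show ?thesis
  proof (cases "c = 0")
    case True
    then show ?thesis by (simp add: p)
  next
    case False
    have "degree ?q = length as"
      by (subst degree_prod_list_eq) (auto simp: sum_list_triv comp_def)
    then have len: "length as \<le> d" using d False by (simp add: p)
    have lag: "(poly (pderiv ?q) x)\<^sup>2 \<le> length as * ?W" by (rule laguerre_roots)
    have "?W \<ge> 0"
    proof (cases "as = []")
      case False
      have "0 \<le> length as * ?W" using lag by (smt (verit) zero_le_power2)
      then show ?thesis using False by (simp add: zero_le_mult_iff)
    qed (simp add: pderiv_1)
    then have "length as * ?W \<le> d * ?W" using len by (intro mult_right_mono) auto
    then have "(poly (pderiv ?q) x)\<^sup>2 \<le> d * ?W" using lag by linarith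
    then have "c\<^sup>2 * (poly (pderiv ?q) x)\<^sup>2 \<le> c\<^sup>2 * (d * ?W)" by (rule mult_left_mono) simp
    then show ?thesis by (simp add: p pderiv_smult power2_eq_square algebra_simps)
  qed
qed

lemma degree_higher_pderiv_le: "degree ((pderiv ^^ r) p) \<le> degree p - r" for p :: "real poly"
proof (induction r)
  case (Suc r)
  have "degree ((pderiv ^^ Suc r) p) = degree ((pderiv ^^ r) p) - 1" by (simp add: degree_pderiv)
  then show ?case using Suc by simp
qed simp

lemma poly_0_higher_pderiv: "poly ((pderiv ^^ r) p) 0 = fact r * coeff p r" for p :: "real poly"
  by (simp add: poly_0_coeff_0 coeff_higher_pderiv flip: pochhammer_fact)

text \<open>Laguerre's inequality at \<open>0\<close> for the derivative of order \<open>j - 1\<close>, whose first three Taylor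
  coefficients come from \<open>coeff p (j - 1)\<close>, \<open>coeff p j\<close> and \<open>coeff p (j + 1)\<close>.\<close>

lemma newton_real_rooted:
  fixes p :: "real poly" and m j :: nat
  assumes "real_rooted p" and m: "degree p \<le> m" and j: "1 \<le> j" "j \<le> m"
  shows "real (j + 1) * real (m - j + 1) * (coeff p (j - 1) * coeff p (j + 1))
    \<le> real j * real (m - j) * (coeff p j)\<^sup>2"
proof -
  obtain r where r: "j = Suc r" using j by (cases j) auto
  define e where "e = m - j"
  let ?q = "(pderiv ^^ r) p"
  have "real_rooted ?q"
    using \<open>real_rooted p\<close> by (induction r) (auto intro: real_rooted_pderiv)
  moreover have "degree ?q \<le> e + 1"
    using degree_higher_pderiv_le[of r p] m j by (simp add: r e_def)
  ultimately have "(poly (pderiv ?q) 0)\<^sup>2 \<le>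
      real (e + 1) * ((poly (pderiv ?q) 0)\<^sup>2 - poly ?q 0 * poly (pderiv (pderiv ?q)) 0)"
    by (rule laguerre_real_rooted)
  moreover have "poly (pderiv ?q) 0 = fact r * (j * coeff p j)"
    using poly_0_higher_pderiv[of "Suc r" p] by (simp add: r algebra_simps)
  moreover have "poly (pderiv (pderiv ?q)) 0 = fact r * (j * ((j + 1) * coeff p (j + 1)))"
    using poly_0_higher_pderiv[of "Suc (Suc r)" p] by (simp add: r algebra_simps)
  moreover have "poly ?q 0 = fact r * coeff p (j - 1)"
    by (simp add: poly_0_higher_pderiv r)
  ultimately have "((fact r :: real)\<^sup>2 * real j) * (real (j + 1) * real (e + 1) * (coeff p (j - 1) * coeff p (j + 1)))
      \<le> ((fact r :: real)\<^sup>2 * real j) * (real j * real e * (coeff p j)\<^sup>2)"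
    by (simp add: power2_eq_square algebra_simps)
  moreover have "(fact r :: real)\<^sup>2 * real j > 0" using j by simp
  ultimately show ?thesis
    unfolding e_def by (simp only: mult_le_cancel_left_pos)
qed

section \<open>Elementary symmetric functions of an indexed family\<close>

text \<open>Defined through the generating polynomial, from which the recurrence, the derivative
  identity and Newton's inequality can be read off directly.\<close>

definition esym :: "('i \<Rightarrow> real) \<Rightarrow> 'i set \<Rightarrow> nat \<Rightarrow> real" where
  "esym l I j = coeff (\<Prod>i\<in>I. [:1, l i:]) j"

lemma esym_0 [simp]: "esym l I 0 = 1"
proof -
  have "esym l I 0 = poly (\<Prod>i\<in>I. [:1, l i:]) 0" by (simp add: esym_def poly_0_coeff_0)
  also have "\<dots> = 1" by (simp add: poly_prod)
  finally show ?thesis .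
qed

lemma esym_eq_sum_subsets:
  assumes "finite I"
  shows "esym l I j = (\<Sum>J | J \<subseteq> I \<and> card J = j. \<Prod>i\<in>J. l i)"
proof -
  have "(\<Prod>i\<in>I. [:1, l i:]) = (\<Prod>i\<in>I. monom (l i) 1 + 1)"
    by (simp add: monom_altdef one_pCons)
  also have "\<dots> = (\<Sum>J\<in>Pow I. (\<Prod>i\<in>J. monom (l i) 1))"
    using assms by (simp add: prod_add)
  also have "\<dots> = (\<Sum>J\<in>Pow I. monom (\<Prod>i\<in>J. l i) (card J))"
  proof (rule sum.cong[OF refl])
    fix J assume "J \<in> Pow I"
    then have "finite J" using assms finite_subset by blast
    then show "(\<Prod>i\<in>J. monom (l i) 1) = monom (\<Prod>i\<in>J. l i) (card J)"
      by (induction J rule: finite_induct) (simp_all add: mult_monom one_pCons monom_0)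
  qed
  finally have "esym l I j = (\<Sum>J\<in>Pow I. if card J = j then \<Prod>i\<in>J. l i else 0)"
    by (simp add: esym_def coeff_sum)
  also have "\<dots> = (\<Sum>J \<in> {J \<in> Pow I. card J = j}. \<Prod>i\<in>J. l i)"
    using assms by (subst sum.inter_filter) auto
  finally show ?thesis by (simp add: Pow_def)
qed

lemma elem_sym_eq_esym: "elem_sym j xs = esym (\<lambda>i. xs ! i) {..<length xs} j"
  by (simp add: elem_sym_def esym_eq_sum_subsets)

lemma elem_sym_cong_mset:
  assumes "mset xs = mset ys"
  shows "elem_sym j xs = elem_sym j ys"
proof -
  have "elem_sym j zs = coeff (\<Prod>z\<in>#mset zs. [:1, z:]) j" for zs
  proof -
    have "(\<Prod>i<length zs. [:1, zs ! i:]) = (\<Prod>z\<leftarrow>zs. [:1, z:])"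
      by (simp add: prod.list_conv_set_nth atLeast0LessThan)
    then show ?thesis by (simp add: elem_sym_eq_esym esym_def flip: prod_mset_prod_list)
  qed
  then show ?thesis using assms by simp
qed

lemma esym_remove:
  assumes "finite I" "i \<in> I"
  shows "esym l I (Suc j) = esym l (I - {i}) (Suc j) + l i * esym l (I - {i}) j"
proof -
  have "(\<Prod>i\<in>I. [:1, l i:]) = [:1, l i:] * (\<Prod>i\<in>I - {i}. [:1, l i:])"
    using assms by (rule prod.remove)
  then show ?thesis by (simp add: esym_def)
qed

text \<open>Comparison of coefficients in the derivative of the generating polynomial. It evaluates
  \<open>tr(T\<^sub>j(A) A)\<close>.\<close>

lemma sum_mult_esym_remove:
  assumes "finite I"
  shows "(\<Sum>i\<in>I. l i * esym l (I - {i}) j) = real (Suc j) * esym l I (Suc j)"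
proof -
  let ?G = "\<lambda>I. \<Prod>i\<in>I. [:1, l i:]"
  have "real (Suc j) * esym l I (Suc j) = coeff (pderiv (?G I)) j"
    by (simp add: esym_def coeff_pderiv)
  also have "pderiv (?G I) = (\<Sum>i\<in>I. ?G (I - {i}) * [:l i:])"
    by (simp add: pderiv_prod pderiv_pCons)
  also have "coeff \<dots> j = (\<Sum>i\<in>I. l i * esym l (I - {i}) j)"
    by (simp add: coeff_sum esym_def)
  finally show ?thesis by simp
qed

text \<open>The left-hand side is the Newton tensor evaluated at the eigenvalue \<open>l i\<close>: it solves the
  recurrence \<open>esym_remove\<close> for the family without \<open>i\<close>.\<close>

lemma sum_esym_power_eq_esym_remove:
  assumes "finite I" "i \<in> I"
  shows "(\<Sum>r\<le>j. (- 1) ^ r * esym l I (j - r) * l i ^ r) = esym l (I - {i}) j"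
proof (induction j)
  case (Suc j)
  have "(\<Sum>r\<le>Suc j. (- 1) ^ r * esym l I (Suc j - r) * l i ^ r)
      = esym l I (Suc j) - l i * (\<Sum>r\<le>j. (- 1) ^ r * esym l I (j - r) * l i ^ r)"
    by (subst sum.atMost_Suc_shift) (simp add: sum_distrib_left sum_negf algebra_simps)
  also have "\<dots> = esym l (I - {i}) (Suc j)"
    unfolding Suc esym_remove[OF assms] by simp
  finally show ?case .
qed simp

section \<open>Newton and Maclaurin inequalities\<close>

lemma newton_inequality:
  fixes l :: "'i \<Rightarrow> real" and j :: nat
  assumes "1 \<le> j" "j \<le> card I"
  shows "real (j + 1) * real (card I - j + 1) * (esym l I (j - 1) * esym l I (j + 1))
    \<le> real j * real (card I - j) * (esym l I j)\<^sup>2"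
proof -
  have "degree (\<Prod>i\<in>I. [:1, l i:]) \<le> (\<Sum>i\<in>I. degree [:1, l i:])"
    using degree_prod_sum_le[of I "\<lambda>i. [:1, l i:]"] assms card_ge_0_finite[of I]
    by (simp add: comp_def)
  also have "\<dots> \<le> (\<Sum>i\<in>I. 1)" by (intro sum_mono) simp
  finally have "degree (\<Prod>i\<in>I. [:1, l i:]) \<le> card I" by simp
  then show ?thesis unfolding esym_def
    using assms by (intro newton_real_rooted real_rooted_prod real_rooted_linear)
qed

lemma esym_log_concave:
  assumes "1 \<le> j" "j \<le> card I"
  shows "esym l I (j - 1) * esym l I (j + 1) \<le> (esym l I j)\<^sup>2"
proof (rule ccontr)
  let ?e = "card I - j"
  assume "\<not> ?thesis"
  then have gt: "(esym l I j)\<^sup>2 < esym l I (j - 1) * esym l I (j + 1)" by simp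
  have "real j * real ?e * (esym l I j)\<^sup>2
      \<le> real j * real ?e * (esym l I (j - 1) * esym l I (j + 1))"
    using gt by (intro mult_left_mono) auto
  also have "\<dots> < real (j + 1) * real (?e + 1) * (esym l I (j - 1) * esym l I (j + 1))"
  proof (intro mult_strict_right_mono)
    show "0 < esym l I (j - 1) * esym l I (j + 1)"
      using gt zero_le_power2[of "esym l I j"] by linarith
  qed (simp add: algebra_simps)
  finally show False using newton_inequality[OF assms, of l] by linarith
qed

text \<open>Removing one number from a family in the cone \<open>\<Gamma>\<^sub>k\<close> leaves a family in \<open>\<Gamma>\<^bsub>k-1\<^esub>\<close>. Let \<open>s\<^sub>j\<close> belong
  to the smaller family and suppose \<open>s\<^bsub>j+1\<^esub>\<close> is the first one that is not positive. Then
  \<open>\<sigma>\<^bsub>j+1\<^esub> > 0\<close> forces \<open>x s\<^sub>j > -s\<^bsub>j+1\<^esub>\<close>, so \<open>x > 0\<close>, and \<open>\<sigma>\<^bsub>j+2\<^esub> > 0\<close> forces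
  \<open>s\<^bsub>j+2\<^esub> > -x s\<^bsub>j+1\<^esub>\<close>. Multiplying the two contradicts log-concavity.\<close>

lemma esym_remove_pos:
  assumes fin: "finite I" and i: "i \<in> I" and k: "k < card I"
    and pos: "\<And>j. 1 \<le> j \<Longrightarrow> j \<le> k \<Longrightarrow> esym l I j > 0"
    and j: "j < k"
  shows "esym l (I - {i}) j > 0"
  using j
proof (induction j)
  case (Suc j)
  let ?s = "esym l (I - {i})" and ?x = "l i"
  have prev: "?s j > 0" using Suc by simp
  show ?case
  proof (rule ccontr)
    assume "\<not> ?s (Suc j) > 0"
    then have np: "?s (Suc j) \<le> 0" by simp
    have "esym l I (Suc j) > 0" "esym l I (Suc (Suc j)) > 0" using pos Suc.prems by simp_all
    then have 1: "?x * ?s j > - ?s (Suc j)" and 2: "?s (Suc (Suc j)) > ?x * (- ?s (Suc j))"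
      unfolding esym_remove[OF fin i] by simp_all
    have "?x * ?s j > 0" using 1 np by linarith
    then have x: "?x > 0" using prev by (simp add: zero_less_mult_iff)
    have "?x * (?s (Suc j))\<^sup>2 = (- ?s (Suc j)) * (?x * (- ?s (Suc j)))"
      by (simp add: power2_eq_square)
    also have "\<dots> \<le> (?x * ?s j) * (?x * (- ?s (Suc j)))"
      using 1 x np by (intro mult_right_mono) (auto intro: mult_nonneg_nonpos)
    also have "\<dots> < (?x * ?s j) * ?s (Suc (Suc j))"
      using 2 x prev by (intro mult_strict_left_mono) auto
    finally have "(?s (Suc j))\<^sup>2 < ?s j * ?s (Suc (Suc j))" using x by (simp add: mult.assoc)
    moreover have "Suc j \<le> card (I - {i})"
      using Suc.prems k fin i by (simp add: card_Diff_singleton)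
    ultimately show False using esym_log_concave[of "Suc j" "I - {i}" l] by simp
  qed
qed simp

text \<open>In terms of the means \<open>p\<^sub>j = s\<^sub>j / (m choose j)\<close>, with \<open>m\<close> the size of the family, this says
  \<open>p\<^sub>j \<le> p\<^sub>1 p\<^bsub>j-1\<^esub>\<close>. Newton's inequality makes the quotients \<open>p\<^sub>j / p\<^bsub>j-1\<^esub>\<close> decrease, and the
  first of them is \<open>p\<^sub>1\<close>.\<close>

lemma maclaurin_step:
  assumes pos: "\<And>r. r < j \<Longrightarrow> esym l I r > 0" and "1 \<le> j" "j \<le> card I"
  shows "real j * real (card I) * esym l I j
    \<le> real (card I - j + 1) * (esym l I 1 * esym l I (j - 1))"
  using \<open>1 \<le> j\<close> \<open>j \<le> card I\<close> pos
proof (induction j rule: nat_induct_at_least)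
  case base
  then show ?case by simp
next
  case (Suc j)
  let ?s = "esym l I" and ?m = "real (card I)" and ?e = "real (card I - j)"
  have e: "real (card I - j + 1) = ?e + 1" "real (card I - Suc j + 1) = ?e"
    using Suc.prems by simp_all
  have sj: "?s j > 0" "?s (j - 1) > 0" using Suc by auto
  have "real j * ?m * ?s j \<le> real (card I - j + 1) * (?s 1 * ?s (j - 1))"
    using Suc.IH Suc.prems by simp
  then have IH: "real j * ?m * ?s j \<le> (?e + 1) * (?s 1 * ?s (j - 1))" unfolding e(1) .
  have N: "real (j + 1) * (?e + 1) * (?s (j - 1) * ?s (j + 1)) \<le> real j * ?e * (?s j)\<^sup>2"
    using newton_inequality[of j I l] Suc.hyps Suc.prems unfolding e(1) by simp
  have "((?e + 1) * ?s (j - 1)) * (real (Suc j) * ?m * ?s (Suc j))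
      = ?m * (real (j + 1) * (?e + 1) * (?s (j - 1) * ?s (j + 1)))"
    by (simp add: algebra_simps)
  also have "\<dots> \<le> ?m * (real j * ?e * (?s j)\<^sup>2)"
    using N by (intro mult_left_mono) auto
  also have "\<dots> = (real j * ?m * ?s j) * (?e * ?s j)" by (simp add: power2_eq_square)
  also have "\<dots> \<le> ((?e + 1) * (?s 1 * ?s (j - 1))) * (?e * ?s j)"
    using IH sj by (intro mult_right_mono) auto
  also have "\<dots> = ((?e + 1) * ?s (j - 1)) * (?e * (?s 1 * ?s j))" by simp
  finally have "real (Suc j) * ?m * ?s (Suc j) \<le> ?e * (?s 1 * ?s j)"
    using sj by (subst (asm) mult_le_cancel_left_pos) auto
  then show ?case unfolding e(2) by simp
qed

section \<open>The inequality for a single eigenvalue\<close>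

text \<open>The theorem for diagonal matrices, one diagonal entry at a time.\<close>

lemma eigenvalue_inequality:
  fixes l :: "'i \<Rightarrow> real" and k :: nat
  assumes fin: "finite I" and i: "i \<in> I" and k: "1 \<le> k" "k < card I"
    and pos: "\<And>j. 1 \<le> j \<Longrightarrow> j \<le> k \<Longrightarrow> esym l I j > 0"
  defines "a \<equiv> (real (card I) - real k) / real (card I)"
  shows "(a * esym l I k - esym l (I - {i}) k)\<^sup>2
    \<le> a * (a * esym l I 1 * esym l I k - real (k + 1) * esym l I (k + 1)) * esym l (I - {i}) (k - 1)"
proof -
  define n where "n = real (card I)"
  define x where "x = l i"
  define s where "s = esym l (I - {i})"
  have n: "n > 0" "real k < n" using k by (simp_all add: n_def)
  have card: "real (card (I - {i})) = n - 1" "card (I - {i}) = card I - 1"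
    using fin i k by (simp_all add: n_def card_Diff_singleton of_nat_diff)
  have na: "n * a = n - k" using n by (simp add: a_def n_def)
  then have a: "a > 0" using n by (simp add: a_def n_def)
  have E1: "esym l I 1 = s 1 + x"
    and Ek: "esym l I k = s k + x * s (k - 1)"
    and Ek1: "esym l I (k + 1) = s (k + 1) + x * s k"
    using esym_remove[OF fin i, of l 0] esym_remove[OF fin i, of l "k - 1"]
      esym_remove[OF fin i, of l k] k
    by (simp_all add: s_def x_def)
  have spos: "s j > 0" if "j < k" for j
    unfolding s_def using esym_remove_pos[OF fin i k(2) pos that] .
  have M: "k * (n - 1) * s k \<le> (n - k) * (s 1 * s (k - 1))"
  proof -
    have "real (card (I - {i}) - k + 1) = n - k" using k card by (simp add: n_def of_nat_diff)
    then show ?thesis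
      using maclaurin_step[of k l "I - {i}"] spos k card by (simp add: s_def)
  qed
  have N: "(k + 1) * (n - k) * (s (k - 1) * s (k + 1)) \<le> k * (n - k - 1) * (s k)\<^sup>2"
  proof -
    have "real (card (I - {i}) - k) = n - k - 1" using k card by (simp add: n_def of_nat_diff)
    then show ?thesis
      using newton_inequality[of k "I - {i}" l] k card by (simp add: s_def algebra_simps)
  qed
  let ?D = "a * (s 1 + x) * (s k + x * s (k - 1)) - real (k + 1) * (s (k + 1) + x * s k)"
  let ?L = "a * (s k + x * s (k - 1)) - s k"
  \<comment> \<open>The difference of the two sides is affine in \<open>x\<close>; the right-hand side below expands it
    around the zero of \<open>s k + x * s (k - 1)\<close>, the value of \<open>\<sigma>\<^sub>k\<close>.\<close>
  have "n\<^sup>2 * (a * ?D * s (k - 1) - ?L\<^sup>2)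
      = (n - k) * (s k + x * s (k - 1)) * ((n - k) * (s 1 * s (k - 1)) - k * (n - 1) * s k)
        + n * (k * (n - k - 1) * (s k)\<^sup>2 - (k + 1) * (n - k) * (s (k - 1) * s (k + 1)))"
  proof -
    have "n\<^sup>2 * (a * ?D * s (k - 1) - ?L\<^sup>2)
      = (n * a) * ((n * a) * (s 1 + x) * (s k + x * s (k - 1)) 
          - n * (real (k + 1) * (s (k + 1) + x * s k))) * s (k - 1)
        - ((n * a) * (s k + x * s (k - 1)) - n * s k)\<^sup>2"
      by (simp add: power2_eq_square algebra_simps)
    then show ?thesis unfolding na by (simp add: power2_eq_square algebra_simps)
  qed
  also have "\<dots> \<ge> 0"
  proof -
    have "s k + x * s (k - 1) > 0" using pos[of k] k by (simp add: Ek)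
    then show ?thesis using M N n by simp
  qed
  finally have "a * ?D * s (k - 1) - ?L\<^sup>2 \<ge> 0" using n by (simp add: zero_le_mult_iff)
  then show ?thesis unfolding E1 Ek Ek1 by (simp flip: s_def)
qed

section \<open>The spectral theorem for real symmetric matrices\<close>

text \<open>For a complex eigenvector \<open>v\<close> the number \<open>h = v\<^sup>* A v = z |v|\<^sup>2\<close> equals its own conjugate, by
  symmetry of \<open>A\<close>; so the eigenvalue \<open>z\<close> is real, and a real root of the characteristic
  polynomial has a real eigenvector.\<close>

lemma real_symmetric_eigenvalue:
  assumes A: "A \<in> sym_mats n" and n: "0 < n"
  shows "\<exists>e. eigenvalue A e"
proof -
  have Ac: "A \<in> carrier_mat n n" and At: "transpose_mat A = A"
    using A by (auto simp: sym_mats_def)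
  let ?C = "map_mat complex_of_real A"
  have C: "?C \<in> carrier_mat n n" using Ac by simp
  have "degree (char_poly ?C) = n" using degree_monic_char_poly[OF C] by simp
  then obtain z where "poly (char_poly ?C) z = 0"
    using n fundamental_theorem_of_algebra[of "char_poly ?C"] constant_degree[of "char_poly ?C"]
    by auto
  then obtain v where v: "v \<in> carrier_vec n" "v \<noteq> 0\<^sub>v n" and ev: "?C *\<^sub>v v = z \<cdot>\<^sub>v v"
    using eigenvalue_root_char_poly[OF C] Ac by (auto simp: eigenvalue_def eigenvector_def)
  have ev_i: "(\<Sum>j<n. of_real (A $$ (i, j)) * v $ j) = z * v $ i" if "i < n" for i
  proof -
    have "(?C *\<^sub>v v) $ i = (\<Sum>j<n. of_real (A $$ (i, j)) * v $ j)"
      using that v Ac by (simp add: scalar_prod_def atLeast0LessThan)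
    then show ?thesis using that v by (simp add: ev)
  qed
  define h where "h = (\<Sum>i<n. \<Sum>j<n. cnj (v $ i) * (of_real (A $$ (i, j)) * v $ j))"
  define N where "N = (\<Sum>i<n. (cmod (v $ i))\<^sup>2)"
  have "h = (\<Sum>i<n. cnj (v $ i) * (z * v $ i))"
    unfolding h_def by (rule sum.cong) (simp_all add: ev_i flip: sum_distrib_left)
  also have "\<dots> = z * of_real N"
    by (simp add: N_def sum_distrib_left complex_norm_square algebra_simps del: of_real_power)
  finally have hz: "h = z * of_real N" .
  have sym: "A $$ (j, i) = A $$ (i, j)" if "i < n" "j < n" for i j
    using that Ac At by (metis carrier_matD index_transpose_mat(1))
  have "cnj h = (\<Sum>i<n. \<Sum>j<n. cnj (v $ j) * (of_real (A $$ (i, j)) * v $ i))"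
    by (simp add: h_def mult_ac)
  also have "\<dots> = (\<Sum>j<n. \<Sum>i<n. cnj (v $ j) * (of_real (A $$ (i, j)) * v $ i))"
    by (rule sum.swap)
  also have "\<dots> = h" unfolding h_def by (intro sum.cong refl) (simp add: sym)
  finally have "Im h = 0" by (simp add: complex_eq_iff)
  moreover have "N \<noteq> 0"
  proof
    assume "N = 0"
    then have "\<forall>i<n. v $ i = 0" by (simp add: N_def sum_nonneg_eq_0_iff)
    then have "v = 0\<^sub>v n" using v by (intro eq_vecI) auto
    with v show False by simp
  qed
  ultimately have "z = of_real (Re z)" by (simp add: hz complex_eq_iff)
  then have "poly (map_poly complex_of_real (char_poly A)) (of_real (Re z)) = 0"
    using \<open>poly (char_poly ?C) z = 0\<close> by (simp add: of_real_hom.char_poly_hom[OF Ac])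
  then have "poly (char_poly A) (Re z) = 0" by simp
  then show ?thesis using eigenvalue_root_char_poly[OF Ac] by blast
qed

lemma real_symmetric_unit_eigenvector:
  assumes A: "A \<in> sym_mats n" and n: "0 < n"
  obtains e u where "u \<in> carrier_vec n" "u \<bullet> u = 1" "A *\<^sub>v u = e \<cdot>\<^sub>v u"
proof -
  have Ac: "A \<in> carrier_mat n n" using A by (auto simp: sym_mats_def)
  obtain e v where v: "v \<in> carrier_vec n" "v \<noteq> 0\<^sub>v n" and ev: "A *\<^sub>v v = e \<cdot>\<^sub>v v"
    using real_symmetric_eigenvalue[OF assms] Ac by (auto simp: eigenvalue_def eigenvector_def)
  define c where "c = 1 / sqrt (v \<bullet> v)"
  have "v \<bullet> v > 0"
    using v conjugate_square_greater_0_vec[of v n] by (simp add: conjugate_vec_def)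
  then have "c * (c * (v \<bullet> v)) = 1" by (simp add: c_def)
  then have "(c \<cdot>\<^sub>v v) \<bullet> (c \<cdot>\<^sub>v v) = 1" using v by simp
  moreover have "A *\<^sub>v (c \<cdot>\<^sub>v v) = e \<cdot>\<^sub>v (c \<cdot>\<^sub>v v)"
    using v Ac ev by (simp add: mult_mat_vec smult_smult_assoc mult.commute)
  ultimately show thesis using that[of "c \<cdot>\<^sub>v v" e] v by simp
qed

text \<open>The reflection that exchanges the first basis vector \<open>e\<close> and \<open>u\<close>. It replaces a completion of
  \<open>u\<close> to an orthonormal basis by an explicit matrix that is its own transpose and inverse.\<close>

lemma householder:
  fixes u :: "real vec"
  assumes u: "u \<in> carrier_vec n" and unit: "u \<bullet> u = 1" and n: "0 < n"
  obtains H where "H \<in> carrier_mat n n" "transpose_mat H = H" "H * H = 1\<^sub>m n"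
    "H *\<^sub>v unit_vec n 0 = u"
proof (cases "u = unit_vec n 0")
  case True
  then show thesis using that[of "1\<^sub>m n"] by simp
next
  case False
  define w where "w = unit_vec n 0 - u"
  define s where "s = w \<bullet> w"
  have w: "w \<in> carrier_vec n" using u by (simp add: w_def)
  have s0: "s > 0"
  proof -
    have "w \<noteq> 0\<^sub>v n"
    proof
      assume "w = 0\<^sub>v n"
      then have "unit_vec n 0 $ i = u $ i" if "i < n" for i
        using that u by (auto simp: w_def vec_eq_iff)
      then show False using False u by (auto simp: vec_eq_iff)
    qed
    then show ?thesis
      using w conjugate_square_greater_0_vec[of w n] by (simp add: s_def conjugate_vec_def)
  qed
  \<comment> \<open>\<open>e\<close> and \<open>u\<close> have the same length, so \<open>(e - u) \<bullet> (e - u) = 2 e \<bullet> (e - u)\<close>; this makes the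
    reflection move \<open>e\<close> by exactly \<open>w = e - u\<close>.\<close>
  have s: "s = 2 * w $ 0"
    using u n unit
    by (simp add: s_def w_def minus_scalar_prod_distrib[of _ n] scalar_prod_minus_distrib[of _ n])
  define H where "H = mat n n (\<lambda>(i, j). (if i = j then 1 else 0) - 2 / s * (w $ i * w $ j))"
  have H: "H \<in> carrier_mat n n" by (simp add: H_def)
  have "transpose_mat H = H" by (rule eq_matI) (auto simp: H_def)
  moreover have "H * H = 1\<^sub>m n"
  proof (rule eq_matI)
    fix i j assume "i < dim_row (1\<^sub>m n)" "j < dim_col (1\<^sub>m n)"
    then have ij: "i < n" "j < n" by auto
    have ww: "(\<Sum>k<n. w $ k * w $ k) = s"
      using w by (simp add: s_def scalar_prod_def atLeast0LessThan)
    have "(H * H) $$ (i, j) = (\<Sum>k<n. ((if i = k then 1 else 0) - 2 / s * (w $ i * w $ k))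
        * ((if k = j then 1 else 0) - 2 / s * (w $ k * w $ j)))"
      using ij by (simp add: H_def scalar_prod_def atLeast0LessThan)
    also have "\<dots> = (\<Sum>k<n. (if i = k then (if i = j then 1 else 0) - 2 / s * (w $ i * w $ j) else 0)
        - (if k = j then 2 / s * (w $ i * w $ j) else 0)
        + (2 / s)\<^sup>2 * (w $ i * w $ j) * (w $ k * w $ k))"
      by (intro sum.cong refl) (simp add: power2_eq_square algebra_simps)
    also have "\<dots> = (if i = j then 1 else 0) - 2 / s * (w $ i * w $ j)
        - 2 / s * (w $ i * w $ j) + (2 / s)\<^sup>2 * (w $ i * w $ j) * s"
      unfolding sum.distrib sum_subtractf sum_distrib_left[symmetric] ww using ij by simp
    also have "\<dots> = (if i = j then 1 else 0)"
      using s0 by (simp add: power2_eq_square field_simps)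
    finally show "(H * H) $$ (i, j) = 1\<^sub>m n $$ (i, j)" using ij by simp
  qed (simp_all add: H_def)
  moreover have "H *\<^sub>v unit_vec n 0 = u"
  proof (rule eq_vecI)
    fix i assume "i < dim_vec u"
    then have i: "i < n" using u by simp
    have "(H *\<^sub>v unit_vec n 0) $ i = H $$ (i, 0)" using i n H by simp
    also have "\<dots> = u $ i"
      using i n u s s0 by (simp add: H_def) (simp add: w_def)
    finally show "(H *\<^sub>v unit_vec n 0) $ i = u $ i" .
  qed (use H u in simp)
  ultimately show thesis using that[of H] H by blast
qed

definition orth_mat :: "nat \<Rightarrow> real mat \<Rightarrow> bool" where
  "orth_mat n U \<longleftrightarrow> U \<in> carrier_mat n n \<and> transpose_mat U * U = 1\<^sub>m n"

text \<open>The matrix \<open>U diag(f) U\<^sup>T\<close>, written entrywise: linear combinations, traces and quadratic forms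
  then become plain sums.\<close>

definition conj_diag :: "real mat \<Rightarrow> (nat \<Rightarrow> real) \<Rightarrow> real mat" where
  "conj_diag U f = mat (dim_row U) (dim_row U)
     (\<lambda>(i, j). \<Sum>r<dim_row U. U $$ (i, r) * f r * U $$ (j, r))"

lemma conj_diag_carrier [simp]: "U \<in> carrier_mat n n \<Longrightarrow> conj_diag U f \<in> carrier_mat n n"
  by (auto simp: conj_diag_def)

lemma conj_diag_eq:
  assumes U: "U \<in> carrier_mat n n"
  shows "conj_diag U f = U * mat_diag n f * transpose_mat U"
  using U by (intro eq_matI)
    (auto simp: conj_diag_def mat_diag_mult_right[OF U] scalar_prod_def atLeast0LessThan)

lemma conj_diag_symmetric: "U \<in> carrier_mat n n \<Longrightarrow> conj_diag U f \<in> sym_mats n"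
  by (auto simp: sym_mats_def conj_diag_def mult_ac intro!: eq_matI sum.cong)

lemma orth_mat_mult:
  assumes "orth_mat n U" "orth_mat n V"
  shows "orth_mat n (U * V)"
proof -
  have U: "U \<in> carrier_mat n n" "transpose_mat U * U = 1\<^sub>m n"
    and V: "V \<in> carrier_mat n n" "transpose_mat V * V = 1\<^sub>m n"
    using assms by (auto simp: orth_mat_def)
  have "transpose_mat (U * V) * (U * V) = transpose_mat V * (transpose_mat U * U) * V"
    using U(1) V(1) by (simp add: transpose_mult[of _ n n _ n] assoc_mult_mat[of _ n n _ n _ n])
  then show ?thesis using U V by (simp add: orth_mat_def)
qed

text \<open>Induction on the size. Conjugating \<open>A\<close> by the reflection \<open>H\<close> that takes the first basis vector
  to a unit eigenvector clears the first column and, by symmetry, the first row outside the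
  corner; the induction hypothesis diagonalizes the remaining block.\<close>

theorem real_spectral_theorem:
  assumes "A \<in> sym_mats n"
  shows "\<exists>U d. orth_mat n U \<and> A = conj_diag U d"
  using assms
proof (induction n arbitrary: A)
  case 0
  then have "A = conj_diag (1\<^sub>m 0) (\<lambda>_. 0)" by (intro eq_matI) (auto simp: sym_mats_def conj_diag_def)
  moreover have "orth_mat 0 (1\<^sub>m 0)" by (simp add: orth_mat_def)
  ultimately show ?case by blast
next
  case (Suc n A)
  let ?N = "Suc n"
  have A: "A \<in> carrier_mat ?N ?N" "transpose_mat A = A" using Suc.prems by (auto simp: sym_mats_def)
  obtain e u where u: "u \<in> carrier_vec ?N" "u \<bullet> u = 1" and ev: "A *\<^sub>v u = e \<cdot>\<^sub>v u"
    using real_symmetric_unit_eigenvector[OF Suc.prems] by blast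
  obtain H where H: "H \<in> carrier_mat ?N ?N" "transpose_mat H = H" "H * H = 1\<^sub>m ?N"
    and Hu: "H *\<^sub>v unit_vec ?N 0 = u"
    using householder[OF u] by blast
  define B where "B = H * A * H"
  have B: "B \<in> carrier_mat ?N ?N" using H A by (simp add: B_def)
  have Bt: "transpose_mat B = B"
    using H A by (simp add: B_def transpose_mult[of _ ?N ?N _ ?N] assoc_mult_mat[of _ ?N ?N _ ?N _ ?N])
  have sym: "B $$ (i, j) = B $$ (j, i)" if "i < ?N" "j < ?N" for i j
    using that B Bt by (metis carrier_matD index_transpose_mat(1))
  have "B *\<^sub>v unit_vec ?N 0 = H *\<^sub>v (A *\<^sub>v (H *\<^sub>v unit_vec ?N 0))"
    using H A by (simp add: B_def assoc_mult_mat_vec[of _ ?N ?N _ ?N])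
  also have "\<dots> = e \<cdot>\<^sub>v (H *\<^sub>v (H *\<^sub>v unit_vec ?N 0))"
    unfolding Hu ev using H u by (simp add: mult_mat_vec)
  also have "\<dots> = e \<cdot>\<^sub>v unit_vec ?N 0"
    using H by (simp flip: assoc_mult_mat_vec[of H ?N ?N H ?N])
  finally have Be: "B *\<^sub>v unit_vec ?N 0 = e \<cdot>\<^sub>v unit_vec ?N 0" .
  have col0: "B $$ (i, 0) = (if i = 0 then e else 0)" if "i < ?N" for i
  proof -
    have "B $$ (i, 0) = (B *\<^sub>v unit_vec ?N 0) $ i" using that B by simp
    also have "\<dots> = (if i = 0 then e else 0)" unfolding Be using that by (simp add: unit_vec_def)
    finally show ?thesis .
  qed
  define A' where "A' = mat n n (\<lambda>(i, j). B $$ (Suc i, Suc j))"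
  have "A' \<in> sym_mats n" by (auto simp: A'_def sym_mats_def sym intro!: eq_matI)
  then obtain V d where V: "orth_mat n V" and A'V: "A' = conj_diag V d" using Suc.IH by blast
  have Vc: "V \<in> carrier_mat n n" "transpose_mat V * V = 1\<^sub>m n" using V by (auto simp: orth_mat_def)
  define W where "W = mat ?N ?N (\<lambda>(i, j). case i of 0 \<Rightarrow> (if j = 0 then 1 else 0)
    | Suc i' \<Rightarrow> (case j of 0 \<Rightarrow> 0 | Suc j' \<Rightarrow> V $$ (i', j')))"
  define d' where "d' = case_nat e d"
  have W: "W \<in> carrier_mat ?N ?N" by (simp add: W_def)
  have "transpose_mat W * W = 1\<^sub>m ?N"
  proof (rule eq_matI)
    fix i j assume "i < dim_row (1\<^sub>m ?N)" "j < dim_col (1\<^sub>m ?N)"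
    then have ij: "i < ?N" "j < ?N" by auto
    have VV: "(\<Sum>r<n. V $$ (r, p) * V $$ (r, q)) = (if p = q then 1 else 0)" if "p < n" "q < n" for p q
    proof -
      have "(transpose_mat V * V) $$ (p, q) = (\<Sum>r<n. V $$ (r, p) * V $$ (r, q))"
        using that Vc(1) by (simp add: scalar_prod_def atLeast0LessThan)
      then show ?thesis using that by (simp add: Vc(2))
    qed
    have "(transpose_mat W * W) $$ (i, j) = (\<Sum>r<?N. W $$ (r, i) * W $$ (r, j))"
      using ij W by (simp add: scalar_prod_def atLeast0LessThan)
    also have "\<dots> = 1\<^sub>m ?N $$ (i, j)"
      unfolding sum.lessThan_Suc_shift using ij
      by (cases i; cases j) (auto simp: W_def VV)
    finally show "(transpose_mat W * W) $$ (i, j) = 1\<^sub>m ?N $$ (i, j)" .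
  qed (use W in auto)
  then have Wo: "orth_mat ?N W" using W by (simp add: orth_mat_def)
  have "B = conj_diag W d'"
  proof (rule eq_matI)
    fix i j assume "i < dim_row (conj_diag W d')" "j < dim_col (conj_diag W d')"
    then have ij: "i < ?N" "j < ?N" using W by (auto simp: conj_diag_def)
    have Bij: "B $$ (Suc p, Suc q) = (\<Sum>r<n. V $$ (p, r) * d r * V $$ (q, r))" if "p < n" "q < n" for p q
    proof -
      have "B $$ (Suc p, Suc q) = A' $$ (p, q)" using that by (simp add: A'_def)
      then show ?thesis using that Vc by (simp add: A'V conj_diag_def)
    qed
    have "conj_diag W d' $$ (i, j) = (\<Sum>r<?N. W $$ (i, r) * d' r * W $$ (j, r))"
      using ij W by (simp add: conj_diag_def)
    also have "\<dots> = B $$ (i, j)"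
      unfolding sum.lessThan_Suc_shift using ij col0 sym[of 0]
      by (cases i; cases j) (auto simp: W_def d'_def Bij)
    finally show "B $$ (i, j) = conj_diag W d' $$ (i, j)" by simp
  qed (use B W in \<open>auto simp: conj_diag_def\<close>)
  moreover have "A = H * B * H"
  proof -
    have "H * B * H = (H * H) * A * (H * H)"
      using H(1) A(1) by (simp add: B_def assoc_mult_mat[of _ ?N ?N _ ?N _ ?N])
    then show ?thesis using H A by simp
  qed
  ultimately have "A = conj_diag (H * W) d'"
    using H W
    by (simp add: conj_diag_eq[of _ ?N] transpose_mult[of _ ?N ?N _ ?N]
        assoc_mult_mat[of _ ?N ?N _ ?N _ ?N] mult_carrier_mat[of _ ?N ?N _ ?N])
  moreover have "orth_mat ?N (H * W)"
    by (rule orth_mat_mult[OF _ Wo]) (simp add: orth_mat_def H)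
  ultimately show ?case by blast
qed

section \<open>Functional calculus for a diagonalized matrix\<close>

lemma conj_diag_mult:
  assumes "orth_mat n U"
  shows "conj_diag U f * conj_diag U g = conj_diag U (\<lambda>r. f r * g r)"
proof -
  have U: "U \<in> carrier_mat n n" "transpose_mat U * U = 1\<^sub>m n"
    using assms by (auto simp: orth_mat_def)
  let ?V = "transpose_mat U"
  have "conj_diag U f * conj_diag U g
      = U * (mat_diag n f * ((?V * U) * mat_diag n g)) * ?V"
    using U(1)
    by (simp add: conj_diag_eq[OF U(1)] assoc_mult_mat[of _ n n _ n _ n] mult_carrier_mat[of _ n n _ n])
  also have "\<dots> = conj_diag U (\<lambda>r. f r * g r)"
    unfolding U(2) conj_diag_eq[OF U(1)] by (simp add: left_mult_one_mat[of _ n n])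
  finally show ?thesis .
qed

lemma conj_diag_one:
  assumes "orth_mat n U"
  shows "conj_diag U (\<lambda>_. 1) = 1\<^sub>m n"
proof -
  have U: "U \<in> carrier_mat n n" "transpose_mat U * U = 1\<^sub>m n"
    using assms by (auto simp: orth_mat_def)
  then have "U * transpose_mat U = 1\<^sub>m n"
    using mat_mult_left_right_inverse[of "transpose_mat U" n U] by simp
  then show ?thesis using U by (simp add: conj_diag_eq)
qed

lemma conj_diag_power:
  assumes "orth_mat n U"
  shows "conj_diag U f ^\<^sub>m j = conj_diag U (\<lambda>r. f r ^ j)"
proof (induction j)
  case 0
  have "dim_row (conj_diag U f) = n" using assms by (auto simp: orth_mat_def conj_diag_def)
  then show ?case by (simp add: conj_diag_one[OF assms])
next
  case (Suc j)
  then show ?case by (simp add: conj_diag_mult[OF assms] mult.commute)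
qed

lemma conj_diag_smult: "c \<cdot>\<^sub>m conj_diag U f = conj_diag U (\<lambda>r. c * f r)"
  by (rule eq_matI) (auto simp: conj_diag_def sum_distrib_left mult_ac)

lemma conj_diag_minus: "conj_diag U f - conj_diag U g = conj_diag U (\<lambda>r. f r - g r)"
  by (rule eq_matI) (auto simp: conj_diag_def algebra_simps sum_subtractf)

lemma conj_diag_cong: 
  assumes "U \<in> carrier_mat n n" "\<And>r. r < n \<Longrightarrow> f r = g r"
  shows "conj_diag U f = conj_diag U g"
  using assms by (auto simp: conj_diag_def intro!: eq_matI sum.cong)

lemma mat_trace_conj_diag:
  assumes "orth_mat n U"
  shows "mat_trace (conj_diag U f) = (\<Sum>r<n. f r)"
proof -
  have U: "U \<in> carrier_mat n n" "transpose_mat U * U = 1\<^sub>m n"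
    using assms by (auto simp: orth_mat_def)
  have unit: "(\<Sum>i<n. U $$ (i, r) * U $$ (i, r)) = 1" if "r < n" for r
  proof -
    have "(transpose_mat U * U) $$ (r, r) = (\<Sum>i<n. U $$ (i, r) * U $$ (i, r))"
      using that U(1) by (simp add: scalar_prod_def atLeast0LessThan)
    then show ?thesis using that by (simp add: U(2))
  qed
  have "mat_trace (conj_diag U f) = (\<Sum>i<n. \<Sum>r<n. U $$ (i, r) * f r * U $$ (i, r))"
    using U(1) by (simp add: mat_trace_def conj_diag_def)
  also have "\<dots> = (\<Sum>r<n. \<Sum>i<n. U $$ (i, r) * f r * U $$ (i, r))" by (rule sum.swap)
  also have "\<dots> = (\<Sum>r<n. f r * (\<Sum>i<n. U $$ (i, r) * U $$ (i, r)))"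
    by (simp add: sum_distrib_left mult_ac)
  also have "\<dots> = (\<Sum>r<n. f r)" by (simp add: unit)
  finally show ?thesis .
qed

lemma pos_semidef_conj_diag:
  assumes U: "U \<in> carrier_mat n n" and f: "\<And>r. r < n \<Longrightarrow> 0 \<le> f r"
  shows "pos_semidef n (conj_diag U f)"
  unfolding pos_semidef_def
proof (intro conjI ballI conj_diag_symmetric[OF U])
  fix v :: "real vec" assume v: "v \<in> carrier_vec n"
  have "v \<bullet> (conj_diag U f *\<^sub>v v)
      = (\<Sum>i<n. \<Sum>j<n. \<Sum>r<n. v $ i * (U $$ (i, r) * f r * U $$ (j, r) * v $ j))"
    using v U by (simp add: scalar_prod_def conj_diag_def atLeast0LessThan sum_distrib_left sum_distrib_right)
  also have "\<dots> = (\<Sum>i<n. \<Sum>r<n. \<Sum>j<n. v $ i * (U $$ (i, r) * f r * U $$ (j, r) * v $ j))"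
    by (rule sum.cong[OF refl sum.swap])
  also have "\<dots> = (\<Sum>r<n. \<Sum>i<n. \<Sum>j<n. v $ i * (U $$ (i, r) * f r * U $$ (j, r) * v $ j))"
    by (rule sum.swap)
  also have "\<dots> = (\<Sum>r<n. f r * (\<Sum>i<n. \<Sum>j<n. (U $$ (i, r) * v $ i) * (U $$ (j, r) * v $ j)))"
    by (simp add: sum_distrib_left mult_ac)
  also have "\<dots> = (\<Sum>r<n. f r * (\<Sum>i<n. U $$ (i, r) * v $ i)\<^sup>2)"
    by (simp only: power2_eq_square sum_product)
  also have "\<dots> \<ge> 0" using f by (intro sum_nonneg mult_nonneg_nonneg) auto
  finally show "0 \<le> v \<bullet> (conj_diag U f *\<^sub>v v)" .
qed

lemma mset_eigenvalue_list_conj_diag: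
  assumes "orth_mat n U"
  shows "mset (eigenvalue_list (conj_diag U d)) = mset (map d [0..<n])"
proof -
  have U: "U \<in> carrier_mat n n" "transpose_mat U * U = 1\<^sub>m n"
    using assms by (auto simp: orth_mat_def)
  then have "U * transpose_mat U = 1\<^sub>m n"
    using mat_mult_left_right_inverse[of "transpose_mat U" n U] by simp
  then have "similar_mat (conj_diag U d) (mat_diag n d)"
    using U by (intro similar_matI[of _ _ U "transpose_mat U" n]) (auto simp: conj_diag_eq)
  then have "char_poly (conj_diag U d) = char_poly (mat_diag n d)" by (rule char_poly_similar)
  also have "\<dots> = (\<Prod>a\<leftarrow>diag_mat (mat_diag n d). [:- a, 1:])"
    by (rule char_poly_upper_triangular[of _ n]) (auto simp: mat_diag_def)
  also have "diag_mat (mat_diag n d) = map d [0..<n]"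
    by (auto simp: diag_mat_def mat_diag_def)
  finally have *: "char_poly (conj_diag U d) = (\<Prod>a\<leftarrow>map d [0..<n]. [:- a, 1:])" .
  have "proots (\<Prod>a\<leftarrow>xs. [:- a, 1:]) = mset xs" for xs :: "real list"
  proof (induction xs)
    case (Cons x xs)
    have "proots ([:- x, 1:] * (\<Prod>a\<leftarrow>xs. [:- a, 1:])) = proots [:- x, 1:] + proots (\<Prod>a\<leftarrow>xs. [:- a, 1:])"
      by (rule proots_mult) (auto simp: prod_list_zero_iff)
    then show ?case unfolding list.map prod_list.Cons by (simp add: Cons)
  qed simp
  then show ?thesis unfolding eigenvalue_list_def * by (simp only: mset_sorted_list_of_multiset)
qed

text \<open>The eigenvalue list is sorted while \<open>d\<close> is not; only the multiset matters to \<open>elem_sym\<close>.\<close>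

lemma sigma_conj_diag:
  assumes "orth_mat n U"
  shows "sigma j (conj_diag U d) = esym d {..<n} j"
proof -
  have "sigma j (conj_diag U d) = elem_sym j (map d [0..<n])"
    unfolding sigma_def by (rule elem_sym_cong_mset[OF mset_eigenvalue_list_conj_diag[OF assms]])
  also have "\<dots> = esym d {..<n} j"
    unfolding elem_sym_eq_esym esym_def by (intro arg_cong2[of _ _ _ _ coeff] prod.cong) auto
  finally show ?thesis .
qed

lemma newton_tensor_conj_diag:
  assumes "orth_mat n U"
  shows "newton_tensor j (conj_diag U d) = conj_diag U (\<lambda>r. esym d ({..<n} - {r}) j)"
proof -
  have U: "U \<in> carrier_mat n n" using assms by (auto simp: orth_mat_def)
  have "newton_tensor j (conj_diag U d)
      = conj_diag U (\<lambda>r. \<Sum>i\<le>j. (- 1) ^ i * esym d {..<n} (j - i) * d r ^ i)"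
  proof (rule eq_matI)
    fix p q assume "p < dim_row (conj_diag U (\<lambda>r. \<Sum>i\<le>j. (- 1) ^ i * esym d {..<n} (j - i) * d r ^ i))"
      "q < dim_col (conj_diag U (\<lambda>r. \<Sum>i\<le>j. (- 1) ^ i * esym d {..<n} (j - i) * d r ^ i))"
    then have pq: "p < n" "q < n" using U by (auto simp: conj_diag_def)
    have "newton_tensor j (conj_diag U d) $$ (p, q) 
        = (\<Sum>i\<le>j. (- 1) ^ i * esym d {..<n} (j - i) * conj_diag U (\<lambda>r. d r ^ i) $$ (p, q))"
      using pq conj_diag_carrier[OF U, of d, THEN carrier_matD(1)]
      by (simp add: newton_tensor_def sigma_conj_diag[OF assms] conj_diag_power[OF assms])
    also have "\<dots> = (\<Sum>i\<le>j. \<Sum>r<n. (- 1) ^ i * esym d {..<n} (j - i) * (U $$ (p, r) * d r ^ i * U $$ (q, r)))"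
      using pq U by (simp add: conj_diag_def sum_distrib_left)
    also have "\<dots> = (\<Sum>r<n. \<Sum>i\<le>j. (- 1) ^ i * esym d {..<n} (j - i) * (U $$ (p, r) * d r ^ i * U $$ (q, r)))"
      by (rule sum.swap)
    also have "\<dots> = conj_diag U (\<lambda>r. \<Sum>i\<le>j. (- 1) ^ i * esym d {..<n} (j - i) * d r ^ i) $$ (p, q)"
      using pq U by (simp add: conj_diag_def sum_distrib_left sum_distrib_right mult_ac)
    finally show "newton_tensor j (conj_diag U d) $$ (p, q)
      = conj_diag U (\<lambda>r. \<Sum>i\<le>j. (- 1) ^ i * esym d {..<n} (j - i) * d r ^ i) $$ (p, q)" .
  qed (simp_all add: newton_tensor_def conj_diag_def)
  also have "\<dots> = conj_diag U (\<lambda>r. esym d ({..<n} - {r}) j)"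
    by (rule conj_diag_cong[OF U]) (simp add: sum_esym_power_eq_esym_remove)
  finally show ?thesis .
qed

lemma L_tensor_conj_diag:
  assumes "orth_mat n U"
  shows "L_tensor k (conj_diag U d) = conj_diag U
    (\<lambda>r. (real n - real k) / real n * esym d {..<n} k - esym d ({..<n} - {r}) k)"
proof -
  have "dim_row (conj_diag U d) = n" using assms by (auto simp: orth_mat_def conj_diag_def)
  then show ?thesis
    by (simp add: L_tensor_def newton_tensor_conj_diag[OF assms] sigma_conj_diag[OF assms]
        conj_diag_smult conj_diag_minus flip: conj_diag_one[OF assms])
qed

section \<open>The matrix inequality\<close>

theorem lemma2p4:
  fixes n k :: nat and A :: "real mat"
  assumes "k \<ge> 2" and "n \<ge> 2 * k"
    and "A \<in> Gamma_cone n k"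
  shows "psd_le n (L_tensor k A ^\<^sub>m 2)
    (((real n - real k) / real n * mat_trace (L_tensor k A * A)) \<cdot>\<^sub>m newton_tensor (k - 1) A)"
proof -
  have "A \<in> sym_mats n" and \<sigma>: "\<And>j. j \<in> {1..k} \<Longrightarrow> sigma j A > 0"
    using assms(3) by (auto simp: Gamma_cone_def)
  then obtain U d where U: "orth_mat n U" and A: "A = conj_diag U d"
    using real_spectral_theorem by blast
  have Uc: "U \<in> carrier_mat n n" using U by (simp add: orth_mat_def)
  let ?I = "{..<n}"
  define a where "a = (real n - real k) / real n"
  define ev where "ev r = a * esym d ?I k - esym d (?I - {r}) k" for r
  define D where "D = a * esym d ?I 1 * esym d ?I k - real (k + 1) * esym d ?I (k + 1)"
  define \<tau> where "\<tau> r = esym d (?I - {r}) (k - 1)" for r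
  have L: "L_tensor k A = conj_diag U ev"
    unfolding A L_tensor_conj_diag[OF U] by (simp add: ev_def[abs_def] a_def)
  have tr: "mat_trace (L_tensor k A * A) = D"
  proof -
    have "mat_trace (L_tensor k A * A) = (\<Sum>r<n. ev r * d r)"
      unfolding L unfolding A by (simp add: conj_diag_mult[OF U] mat_trace_conj_diag[OF U])
    also have "\<dots> = a * esym d ?I k * (\<Sum>r<n. d r) - (\<Sum>r<n. d r * esym d (?I - {r}) k)"
      unfolding ev_def left_diff_distrib sum_subtractf sum_distrib_left by (simp only: mult_ac)
    also have "(\<Sum>r<n. d r) = esym d ?I 1"
      using sum_mult_esym_remove[of ?I d 0] by simp
    also have "(\<Sum>r<n. d r * esym d (?I - {r}) k) = real (k + 1) * esym d ?I (k + 1)"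
      using sum_mult_esym_remove[of ?I d k] by simp
    finally show ?thesis by (simp add: D_def)
  qed
  have "pos_semidef n (conj_diag U (\<lambda>r. a * D * \<tau> r - (ev r)\<^sup>2))"
  proof (rule pos_semidef_conj_diag[OF Uc])
    fix r assume "r < n"
    moreover have "esym d ?I j > 0" if "1 \<le> j" "j \<le> k" for j
      using \<sigma>[of j] that by (simp add: A sigma_conj_diag[OF U])
    ultimately show "0 \<le> a * D * \<tau> r - (ev r)\<^sup>2"
      using eigenvalue_inequality[of ?I r k d] assms(1,2)
      by (simp add: a_def ev_def D_def \<tau>_def)
  qed
  moreover have "L_tensor k A ^\<^sub>m 2 = conj_diag U (\<lambda>r. (ev r)\<^sup>2)"
    unfolding L by (rule conj_diag_power[OF U])
  moreover have "(a * mat_trace (L_tensor k A * A)) \<cdot>\<^sub>m newton_tensor (k - 1) A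
      = conj_diag U (\<lambda>r. a * D * \<tau> r)"
    unfolding tr unfolding A newton_tensor_conj_diag[OF U] conj_diag_smult \<tau>_def ..
  ultimately show ?thesis
    using Uc unfolding psd_le_def a_def[symmetric] by (simp add: conj_diag_minus)
qed

end
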